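(* Let $f:\mathbb{R}^n\to\mathbb{R}$ be twice continuously differentiable and $\mu$-strongly convex for some $\mu>0$, let $g:\mathbb{R}^n\to(-\infty,\infty]$ be closed convex, let $\nu>0$, and let $x^*$ be the minimizer of $f+g$. Suppose that $\partial_B\mathrm{prox}_{\nu g}$ is a linear Newton approximation (LNA) of $\mathrm{prox}_{\nu g}$ at $x^*-\nu\nabla f(x^* )$. Then there exist $\epsilon>0$ and $\Delta>0$ such that if $\|x^{(1)}-x^*\|_2<\epsilon$ and $\|B^{(k)}-\nabla^2f(x^{(k)})\|<\Delta$ for all $k=1,2,\ldots$, then the sequence $\{x^{(k)}\}$ generated by the hybrid linear quasi-Newton method converges linearly to $x^*$.
   Context: $\|\cdot\|_2$ is the Euclidean norm and $\|\cdot\|$ the operator norm on $\mathbb{R}^{n\times n}$. $f$ is $\mu$-strongly convex if $f((1-\lambda)x+\lambda y)\le(1-\lambda)f(x)+\lambda f(y)-\frac{\mu}{2}\lambda(1-\lambda)\|x-y\|_2^2$ for all $x,y$ and $0\le\lambda\le1$. $g$ closed means all sublevel sets are closed; $g$ is not identically $+\infty$. Proximal map: $\mathrm{prox}_{h}(x)=\mathrm{argmin}_{y}\{h(y)+\frac12\|y-x\|_2^2\}$. It is Lipschitz continuous with constant $1$ for closed convex $h$. B-subdifferential of a Lipschitz continuous $F:\mathbb{R}^n\to\mathbb{R}^n$ at $x$: $\partial_BF(x)$ is the set of $V\in\mathbb{R}^{n\times n}$ for which there is a sequence $z^{(k)}\to x$ of points at which $F$ is differentiable with $\nabla F(z^{(k)})\to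 V$ ($\nabla F$ denotes the Jacobian). LNA: for a continuous $F:\mathbb{R}^n\to\mathbb{R}^n$, a set-valued function $\mathcal{A}$ assigning to each $y\in\mathbb{R}^n$ a subset $\mathcal{A}(y)\subset\mathbb{R}^{n\times n}$ is an LNA of $F$ at $x$ if (i) every $\mathcal{A}(y)$ is compact; (ii) $\mathcal{A}$ is upper-semicontinuous at $x$: for every $\epsilon>0$ there is $\delta>0$ such that $\|x-y\|_2<\delta$ implies $\mathcal{A}(y)\subset\mathcal{A}(x)+\{A:\|A\|<\epsilon\}$; (iii) $\|F(x)-F(y)-A(x-y)\|_2=o(\|x-y\|_2)$ as $y\to x$, uniformly over $A\in\mathcal{A}(y)$. Define $F_\nu(x)=x-\mathrm{prox}_{\nu g}(x-\nu\nabla f(x))$; $F_\nu(x)=0$ if and only if $x=x^*$. Hybrid linear quasi-Newton method: given $x^{(1)}\in\mathbb{R}^n$ and a symmetric positive definite $B^{(1)}\in\mathbb{R}^{n\times n}$, for $k=1,2,\dots$: (1) choose any $V^{(k)}\in\partial_B\mathrm{prox}_{\nu g}(x^{(k)}-\nu\nabla f(x^{(k)}))$ and set $d^{(k)}=-\left(I-V^{(k)}(I-\nu B^{(k)})\right)^{-1}F_\nu(x^{(k)})$; (2) set $x^{(k+1)}=x^{(k)}+d^{(k)}$; (3) with $s^{(k)}=x^{(k+1)}-x^{(k)}$ and $y^{(k)}=\nabla f(x^{(k+1)})-\nabla f(x^{(k)})$, set $$B^{(k+1)}=B^{(k)}-\frac{B^{(k)}s^{(k)}(s^{(k)})^TB^{(k)}}{(s^{(k)})^TB^{(k)}s^{(k)}}+\frac{y^{(k)}(y^{(k)})^T}{(y^{(k)})^Ts^{(k)}}.$$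 If $x^{(k)}=x^*$ at some $k$ the method has converged and stops (the sequences $x^{(k)}$, $B^{(k)}$ are then regarded as constant from that index on). Linear convergence to $x^*$: $x^{(k)}\to x^*$ and there is $c\in(0,1)$ with $\|x^{(k+1)}-x^*\|_2\le c\,\|x^{(k)}-x^*\|_2$ for all $k$. *)

theory Defs
  imports "HOL-Analysis.Analysis"
begin

definition gradient :: "('a::euclidean_space \<Rightarrow> real) \<Rightarrow> 'a \<Rightarrow> 'a" where
  "gradient f x = (THE D. GDERIV f x :> D)"

definition hessian :: "(real^'n \<Rightarrow> real) \<Rightarrow> real^'n \<Rightarrow> real^'n^'n" where
  "hessian f x = jacobian (gradient f) (at x)"

text \<open>The differentiability clauses make \<^const>\<open>gradient\<close> and \<^const>\<open>hessian\<close> denote the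
  actual derivatives.\<close>

definition twice_continuously_differentiable :: "(real^'n \<Rightarrow> real) \<Rightarrow> bool" where
  "twice_continuously_differentiable f \<longleftrightarrow>
     (\<forall>x. f differentiable (at x)) \<and>
     (\<forall>x. gradient f differentiable (at x)) \<and>
     continuous_on UNIV (hessian f)"

definition strongly_convex :: "real \<Rightarrow> (real^'n \<Rightarrow> real) \<Rightarrow> bool" where
  "strongly_convex \<mu> f \<longleftrightarrow>
     (\<forall>x y. \<forall>t\<in>{0..1}.
        f ((1 - t) *\<^sub>R x + t *\<^sub>R y)
          \<le> (1 - t) * f x + t * f y - \<mu> / 2 * t * (1 - t) * (norm (x - y))\<^sup>2)"

text \<open>Functions into $(-\infty,\infty]$ are modelled as \<^typ>\<open>ereal\<close>-valued functions that never
  take the value $-\infty$; the library's \<^const>\<open>convex_on\<close> covers only real-valued functions.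
  In \<^typ>\<open>ereal\<close> we have $0 \cdot \infty = 0$, so the convexity inequality is trivial at the
  endpoints $t = 0$ and $t = 1$.\<close>

definition convex_ext :: "(real^'n \<Rightarrow> ereal) \<Rightarrow> bool" where
  "convex_ext g \<longleftrightarrow>
     (\<forall>x y. \<forall>t\<in>{0..1}.
        g ((1 - t) *\<^sub>R x + t *\<^sub>R y) \<le> ereal (1 - t) * g x + ereal t * g y)"

definition closed_ext :: "(real^'n \<Rightarrow> ereal) \<Rightarrow> bool" where
  "closed_ext g \<longleftrightarrow> (\<forall>c::real. closed {x. g x \<le> ereal c})"

definition prox :: "(real^'n \<Rightarrow> ereal) \<Rightarrow> real^'n \<Rightarrow> real^'n" where
  "prox h x = arg_min (\<lambda>y. h y + ereal (1 / 2 * (norm (y - x))\<^sup>2)) (\<lambda>_. True)"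

definition B_subdifferential :: "(real^'n \<Rightarrow> real^'n) \<Rightarrow> real^'n \<Rightarrow> (real^'n^'n) set" where
  "B_subdifferential F x =
     {V. \<exists>z::nat \<Rightarrow> real^'n. z \<longlonglongrightarrow> x \<and> (\<forall>k. F differentiable (at (z k))) \<and>
           (\<lambda>k. jacobian F (at (z k))) \<longlonglongrightarrow> V}"

text \<open>The operator norm; the \<^const>\<open>norm\<close> of the matrix type is the Frobenius norm.\<close>

definition op_norm :: "real^'n^'n \<Rightarrow> real" where
  "op_norm A = onorm ((*v) A)"

text \<open>Linear Newton approximation of \<open>F\<close> at \<open>x\<close>. The third clause spells out the
  uniform $o(\|x-y\|)$; its \<open>\<delta>\<close> does not depend on \<open>A\<close>.\<close>

definition LNA :: "(real^'n \<Rightarrow> real^'n) \<Rightarrow> (real^'n \<Rightarrow> (real^'n^'n) set) \<Rightarrow> real^'n \<Rightarrow> bool" where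
  "LNA F \<A> x \<longleftrightarrow>
     (\<forall>y. compact (\<A> y)) \<and>
     (\<forall>\<epsilon>>0. \<exists>\<delta>>0. \<forall>y. norm (x - y) < \<delta> \<longrightarrow>
        \<A> y \<subseteq> {A + E | A E. A \<in> \<A> x \<and> op_norm E < \<epsilon>}) \<and>
     (\<forall>\<epsilon>>0. \<exists>\<delta>>0. \<forall>y. norm (x - y) < \<delta> \<longrightarrow>
        (\<forall>A\<in>\<A> y. norm (F x - F y - A *v (x - y)) \<le> \<epsilon> * norm (x - y)))"

definition prox_residual ::
  "(real^'n \<Rightarrow> real) \<Rightarrow> (real^'n \<Rightarrow> ereal) \<Rightarrow> real \<Rightarrow> real^'n \<Rightarrow> real^'n" where
  "prox_residual f g \<nu> x = x - prox (\<lambda>y. ereal \<nu> * g y) (x - \<nu> *\<^sub>R gradient f x)"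

definition sym_pos_def :: "real^'n^'n \<Rightarrow> bool" where
  "sym_pos_def A \<longleftrightarrow> transpose A = A \<and> (\<forall>v. v \<noteq> 0 \<longrightarrow> v \<bullet> (A *v v) > 0)"

definition outer :: "real^'n \<Rightarrow> real^'n \<Rightarrow> real^'n^'n" where
  "outer u v = (columnvector u :: real^1^'n) ** (rowvector v :: real^'n^1)"

definition BFGS_update :: "real^'n^'n \<Rightarrow> real^'n \<Rightarrow> real^'n \<Rightarrow> real^'n^'n" where
  "BFGS_update B s y =
     B - (1 / (s \<bullet> (B *v s))) *\<^sub>R (B ** outer s s ** B) + (1 / (y \<bullet> s)) *\<^sub>R outer y y"

text \<open>\<open>x\<close> and \<open>B\<close> are the iterates, indexed from 1 (the values at index 0 are irrelevant), of
  some run of the method, with some admissible choice of \<open>V\<close> in each step. Once an iterate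
  equals the solution \<open>xs\<close> the sequences are constant. Invertibility of the matrix in the Newton
  step is not required; if it is singular, \<^const>\<open>matrix_inv\<close> has an unspecified value.\<close>

definition hybrid_quasi_newton ::
  "(real^'n \<Rightarrow> real) \<Rightarrow> (real^'n \<Rightarrow> ereal) \<Rightarrow> real \<Rightarrow> real^'n \<Rightarrow>
   (nat \<Rightarrow> real^'n) \<Rightarrow> (nat \<Rightarrow> real^'n^'n) \<Rightarrow> bool" where
  "hybrid_quasi_newton f g \<nu> xs x B \<longleftrightarrow>
     sym_pos_def (B 1) \<and>
     (\<forall>k\<ge>1.
        if x k = xs then x (Suc k) = x k \<and> B (Suc k) = B k
        else
          (\<exists>V \<in> B_subdifferential (prox (\<lambda>y. ereal \<nu> * g y)) (x k - \<nu> *\<^sub>R gradient f (x k)).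
             x (Suc k) = x k +
               (- (matrix_inv (mat 1 - V ** (mat 1 - \<nu> *\<^sub>R B k)) *v prox_residual f g \<nu> (x k)))) \<and>
          B (Suc k) = BFGS_update (B k) (x (Suc k) - x k)
                        (gradient f (x (Suc k)) - gradient f (x k)))"

definition converges_linearly :: "(nat \<Rightarrow> real^'n) \<Rightarrow> real^'n \<Rightarrow> bool" where
  "converges_linearly x xs \<longleftrightarrow>
     x \<longlonglongrightarrow> xs \<and>
     (\<exists>c. 0 < c \<and> c < 1 \<and> (\<forall>k\<ge>1. norm (x (Suc k) - xs) \<le> c * norm (x k - xs)))"

end

theory Submission
  imports Defs
begin

text \<open>
  Let \<open>P\<close> be the proximal map of \<open>\<nu> g\<close> and \<open>G\<close> the gradient of \<open>f\<close>. The solution satisfies the fixed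
  point equation \<open>P (xs - \<nu> G xs) = xs\<close>. One step of the method is a Newton step for the residual
  \<open>x - P (x - \<nu> G x)\<close> with matrix \<open>M = I - V (I - \<nu> B)\<close>, and the theorem follows from two facts.

  First, \<open>M\<close> is invertible with a bound on the inverse that does not depend on the iterate
  (\<open>newton_matrix_lower_bound\<close>). The proximal map is firmly nonexpansive, and this passes to the limits of
  its Jacobians: \<open>\<parallel>V w\<parallel>\<^sup>2 \<le> V w \<bullet> w\<close>. Close to \<open>xs\<close> the matrix \<open>B\<close> is near the Hessian at \<open>xs\<close>, so
  \<open>B\<close> is bounded, and its quadratic form is at least \<open>\<mu> / 2\<close> by strong convexity. These inequalities
  alone bound \<open>\<parallel>u\<parallel>\<close> by a multiple of \<open>\<parallel>M u\<parallel>\<close>.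

  Second, \<open>M\<close> applied to the new error is small compared with the old one (\<open>newton_step_error\<close>). It is
  the sum of the linearization error of \<open>P\<close>, controlled by the linear Newton approximation, and of
  \<open>-\<nu> V (G x - G xs - B (x - xs))\<close>, controlled by the differentiability of \<open>G\<close>, the continuity of the
  Hessian and the distance of \<open>B\<close> from it.

  Close enough to the solution a step therefore halves the error, and the iterates never leave the
  neighbourhood, where the next step is again controlled by the closeness of \<open>B\<close> to the Hessian,
  which holds along the whole run.

  The values of \<^const>\<open>prox\<close> mean something only if the proximal objective attains its minimum. The
  first-order condition at \<open>xs\<close> gives an affine minorant of \<open>g\<close>, and with it the sublevel sets of the
  objective are compact (\<open>prox_objective_attains_minimum\<close>).
\<close>

section \<open>Directional limits and gradients\<close>

text \<open>The bridge from inequalities between values of a function to inequalities for its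
  derivative; it is used for gradients, for Jacobians of the proximal map and for the Hessian.\<close>

lemma directional_difference_quotient_tendsto:
  fixes F :: "'a::real_normed_vector \<Rightarrow> 'b::real_normed_vector"
  assumes "(F has_derivative F') (at x)"
  shows "((\<lambda>t. (F (x + t *\<^sub>R d) - F x) /\<^sub>R t) \<longlongrightarrow> F' d) (at_right 0)"
proof (rule tendstoI)
  fix e :: real assume "e > 0"
  define c where "c = e / (2 * (norm d + 1))"
  have "c > 0" using \<open>e > 0\<close> by (simp add: c_def add_nonneg_pos)
  interpret F': bounded_linear F' using assms by (rule has_derivative_bounded_linear)
  obtain r where r: "r > 0"
    "\<And>y. norm (y - x) < r \<Longrightarrow> norm (F y - F x - F' (y - x)) \<le> c * norm (y - x)"
    using assms \<open>c > 0\<close> unfolding has_derivative_at_alt by blast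
  have "dist ((F (x + t *\<^sub>R d) - F x) /\<^sub>R t) (F' d) < e"
    if t: "0 < t" "t < r / (norm d + 1)" for t
  proof -
    have "0 < norm d + 1" by (simp add: add_nonneg_pos)
    then have "t * (norm d + 1) < r"
      using t(2) by (simp only: pos_less_divide_eq)
    then have "norm (t *\<^sub>R d) < r"
      using t(1) by (simp add: field_simps)
    then have "norm (F (x + t *\<^sub>R d) - F x - t *\<^sub>R F' d) \<le> c * (t * norm d)"
      using r(2)[of "x + t *\<^sub>R d"] t(1) by (simp add: F'.scaleR)
    moreover have "(F (x + t *\<^sub>R d) - F x) /\<^sub>R t - F' d
        = (F (x + t *\<^sub>R d) - F x - t *\<^sub>R F' d) /\<^sub>R t"
      using t(1) by (simp add: scaleR_diff_right)
    ultimately have "norm ((F (x + t *\<^sub>R d) - F x) /\<^sub>R t - F' d) \<le> c * norm d"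
      using t(1) by (simp add: divide_simps mult_ac)
    also have "\<dots> < e"
    proof -
      have "c * norm d \<le> c * (norm d + 1)" using \<open>c > 0\<close> by simp
      also have "c * (norm d + 1) = e / 2"
        unfolding c_def by (simp add: add_nonneg_pos field_simps add_nonneg_eq_0_iff)
      finally show ?thesis using \<open>e > 0\<close> by simp
    qed
    finally show ?thesis by (simp add: dist_norm)
  qed
  moreover have "r / (norm d + 1) > 0" using r(1) by (simp add: add_nonneg_pos)
  ultimately show "\<forall>\<^sub>F t in at_right 0. dist ((F (x + t *\<^sub>R d) - F x) /\<^sub>R t) (F' d) < e"
    unfolding eventually_at_right_field by blast
qed

text \<open>Linear functionals on a Euclidean space are inner products with a vector, here the adjoint
  applied to 1, so the definite description that defines the gradient does pick the derivative.\<close>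

lemma GDERIV_gradient:
  assumes "f differentiable (at x)"
  shows "GDERIV f x :> gradient f x"
proof -
  obtain f' where f': "(f has_derivative f') (at x)"
    using assms unfolding differentiable_def by blast
  then have "linear f'" by (rule has_derivative_linear)
  then have "f' = (\<lambda>h. h \<bullet> adjoint f' 1)" by (simp add: adjoint_works)
  with f' have ex: "GDERIV f x :> adjoint f' 1" by (simp add: gderiv_def)
  have "D = adjoint f' 1" if "GDERIV f x :> D" for D
  proof -
    have "(\<lambda>h. h \<bullet> D) = (\<lambda>h. h \<bullet> adjoint f' 1)"
      using that ex unfolding gderiv_def by (rule has_derivative_unique)
    then have "h \<bullet> D = h \<bullet> adjoint f' 1" for h by (rule fun_cong)
    then have "\<forall>h. h \<bullet> D = h \<bullet> adjoint f' 1" by blast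
    then show ?thesis by (rule iffD1[OF vector_eq_ldot])
  qed
  then have "gradient f x = adjoint f' 1"
    unfolding gradient_def using the_equality[where P = "\<lambda>D. GDERIV f x :> D"] ex by blast
  with ex show ?thesis by simp
qed

section \<open>Subgradients\<close>

text \<open>Besides the subgradient inequality, \<open>h x\<close> has to be finite: otherwise every vector would be a
  subgradient at a point where \<open>h\<close> is \<open>-\<infinity>\<close>.\<close>

definition subgradient :: "('a::real_inner \<Rightarrow> ereal) \<Rightarrow> 'a \<Rightarrow> 'a \<Rightarrow> bool" where
  "subgradient h x v \<longleftrightarrow> \<bar>h x\<bar> \<noteq> \<infinity> \<and> (\<forall>y. h x + ereal (v \<bullet> (y - x)) \<le> h y)"

lemma subgradient_monotone:
  assumes "subgradient h x u" "subgradient h y v"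
  shows "(u - v) \<bullet> (x - y) \<ge> 0"
proof -
  obtain a b where "h x = ereal a" "h y = ereal b"
    using assms unfolding subgradient_def by auto
  then have "a + u \<bullet> (y - x) \<le> b" "b + v \<bullet> (x - y) \<le> a"
    using assms unfolding subgradient_def by (metis ereal_less_eq(3) plus_ereal.simps(1))+
  then show ?thesis by (simp add: inner_diff)
qed

text \<open>Fermat's rule for the sum of a smooth and a convex function. Along the segment to \<open>y\<close>
  the decrease of \<open>h\<close> is at least \<open>t (h x - h y)\<close>, by convexity, and minimality makes the increase
  of \<open>f\<close> at least as large; dividing by \<open>t\<close> and letting \<open>t\<close> tend to 0 leaves the derivative of \<open>f\<close>.
  The rule serves twice: for \<open>f + g\<close> at the solution, and for the objective of the proximal map.\<close>

lemma minus_gradient_subgradient_at_minimizer: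
  assumes conv: "convex_ext h" and grad: "GDERIV f x :> D"
    and fin: "\<bar>h x\<bar> \<noteq> \<infinity>" and nomin: "\<And>y. h y \<noteq> -\<infinity>"
    and min: "\<And>y. ereal (f x) + h x \<le> ereal (f y) + h y"
  shows "subgradient h x (- D)"
proof -
  obtain a where a: "h x = ereal a" using fin by auto
  have "h x + ereal ((- D) \<bullet> (y - x)) \<le> h y" for y
  proof (cases "h y")
    case (real b)
    have quot: "a - b \<le> (f (x + t *\<^sub>R (y - x)) - f x) /\<^sub>R t" if t: "0 < t" "t < 1" for t
    proof -
      have eq: "(1 - t) *\<^sub>R x + t *\<^sub>R y = x + t *\<^sub>R (y - x)"
        by (simp add: algebra_simps)
      have "h (x + t *\<^sub>R (y - x)) \<le> ereal ((1 - t) * a + t * b)"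
        using conv t a real unfolding convex_ext_def
        by (metis (no_types, lifting) eq atLeastAtMost_iff less_imp_le plus_ereal.simps(1) times_ereal.simps(1))
      then have "ereal (f x) + h x \<le> ereal (f (x + t *\<^sub>R (y - x))) + ereal ((1 - t) * a + t * b)"
        using min[of "x + t *\<^sub>R (y - x)"] by (meson add_left_mono order_trans)
      then have "t * (a - b) \<le> f (x + t *\<^sub>R (y - x)) - f x"
        using a by (simp add: algebra_simps)
      then show ?thesis using t by (simp add: field_simps)
    qed
    have "((\<lambda>t. (f (x + t *\<^sub>R (y - x)) - f x) /\<^sub>R t) \<longlongrightarrow> (y - x) \<bullet> D) (at_right 0)"
      using directional_difference_quotient_tendsto grad unfolding gderiv_def by blast
    moreover have "\<forall>\<^sub>F t in at_right 0. a - b \<le> (f (x + t *\<^sub>R (y - x)) - f x) /\<^sub>R t"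
      unfolding eventually_at_right_field using quot by (intro exI[of _ 1]) auto
    ultimately have "a - b \<le> (y - x) \<bullet> D"
      by (intro tendsto_lowerbound) auto
    then show ?thesis using a real by (simp add: inner_commute)
  qed (use nomin in auto)
  with fin show ?thesis unfolding subgradient_def by blast
qed

section \<open>The proximal map\<close>

lemma GDERIV_half_dist_squared:
  "GDERIV (\<lambda>y. 1 / 2 * (norm (y - x))\<^sup>2) p :> p - x"
proof -
  have "((\<lambda>y. 1 / 2 * ((y - x) \<bullet> (y - x))) has_derivative (\<lambda>d. d \<bullet> (p - x))) (at p)"
    by (auto intro!: derivative_eq_intros simp: inner_commute)
  then show ?thesis unfolding gderiv_def power2_norm_eq_inner .
qed

text \<open>The subgradient inequality makes the proximal objective at \<open>y\<close> exceed its value at \<open>p\<close> by at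
  least half the squared distance of \<open>y\<close> from \<open>p\<close>. Hence \<open>p\<close> is the only minimizer, and the choice
  made by \<^const>\<open>prox\<close> is forced.\<close>

lemma prox_eqI:
  assumes "subgradient h p (x - p)"
  shows "prox h x = p"
proof -
  let ?G = "\<lambda>y. h y + ereal (1 / 2 * (norm (y - x))\<^sup>2)"
  obtain a where a: "h p = ereal a" using assms unfolding subgradient_def by auto
  have lower: "?G p + ereal (1 / 2 * (norm (y - p))\<^sup>2) \<le> ?G y" for y
  proof -
    have "h p + ereal ((x - p) \<bullet> (y - p)) \<le> h y"
      using assms unfolding subgradient_def by blast
    then have "h p + ereal ((x - p) \<bullet> (y - p)) + ereal (1 / 2 * (norm (y - x))\<^sup>2) \<le> ?G y"
      by (rule add_right_mono)
    moreover have "(x - p) \<bullet> (y - p) + 1 / 2 * (norm (y - x))\<^sup>2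
        = 1 / 2 * (norm (p - x))\<^sup>2 + 1 / 2 * (norm (y - p))\<^sup>2"
      unfolding power2_norm_eq_inner by (simp add: inner_diff inner_commute algebra_simps)
    ultimately show ?thesis using a by (simp add: add.assoc)
  qed
  have strict: "?G p < ?G y" if "y \<noteq> p" for y
  proof -
    have "?G p < ?G p + ereal (1 / 2 * (norm (y - p))\<^sup>2)" using a that by simp
    then show ?thesis using lower by (rule less_le_trans)
  qed
  then have min: "is_arg_min ?G (\<lambda>_. True) p"
    unfolding is_arg_min_def by (metis less_asym)
  show "prox h x = p"
    unfolding prox_def arg_min_def
    using min strict by (intro some_equality) (auto simp: is_arg_min_def)
qed

text \<open>A closed function is lower semicontinuous, and adding a continuous function preserves
  this.\<close>

lemma closed_sublevel_add_continuous:
  fixes h :: "real^'n \<Rightarrow> ereal" and q :: "real^'n \<Rightarrow> real"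
  assumes "closed_ext h" and "continuous_on UNIV q"
  shows "closed {y. h y + ereal (q y) \<le> ereal c}"
  unfolding closed_sequential_limits
proof (intro allI impI)
  fix z l assume z: "(\<forall>n. z n \<in> {y. h y + ereal (q y) \<le> ereal c}) \<and> z \<longlonglongrightarrow> l"
  have "h l \<le> ereal (c - q l)"
  proof (rule ereal_le_epsilon2)
    fix e :: real assume "e > 0"
    have "(\<lambda>n. q (z n)) \<longlonglongrightarrow> q l"
      using assms(2) z by (auto intro: continuous_on_tendsto_compose)
    then have "\<forall>\<^sub>F n in sequentially. q l - e < q (z n)"
      using \<open>e > 0\<close> by (intro order_tendstoD(1)) auto
    moreover have "h (z n) \<le> ereal (c - q l + e)" if "q l - e < q (z n)" for n
    proof -
      have "h (z n) + ereal (q (z n)) \<le> ereal c" using z by auto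
      then show ?thesis using that by (cases "h (z n)") auto
    qed
    ultimately have "\<forall>\<^sub>F n in sequentially. z n \<in> {y. h y \<le> ereal (c - q l + e)}"
      by (auto elim: eventually_mono)
    moreover have "closed {y. h y \<le> ereal (c - q l + e)}"
      using assms(1) unfolding closed_ext_def by blast
    ultimately have "l \<in> {y. h y \<le> ereal (c - q l + e)}"
      using z by (intro Lim_in_closed_set) auto
    then show "h l \<le> ereal (c - q l) + ereal e" by simp
  qed
  then show "l \<in> {y. h y + ereal (q y) \<le> ereal c}" by (cases "h l") auto
qed

text \<open>A subgradient of \<open>h\<close> at a single point gives an affine minorant. Adding the quadratic term,
  the objective is bounded below by a paraboloid with vertex at \<open>x - v\<close>, so its sublevel sets are
  compact, and the nested nonempty ones have a common point. In the application such a
  subgradient is at hand, since the solution of the optimization problem provides one; this saves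
  the separation argument that constructs a minorant of a general closed convex function.\<close>

lemma prox_objective_attains_minimum:
  fixes h :: "real^'n \<Rightarrow> ereal"
  assumes closed: "closed_ext h" and sub: "subgradient h p v"
  shows "\<exists>z. \<forall>y. h z + ereal (1 / 2 * (norm (z - x))\<^sup>2) \<le> h y + ereal (1 / 2 * (norm (y - x))\<^sup>2)"
proof -
  define q where "q y = 1 / 2 * (norm (y - x))\<^sup>2" for y :: "real^'n"
  obtain a where a: "h p = ereal a" using sub unfolding subgradient_def by auto
  define S where "S c = {y. h y + ereal (q y) \<le> ereal c}" for c :: real
  \<comment> \<open>the minimum of the paraboloid that bounds the objective from below\<close>
  define \<kappa> where "\<kappa> = a + v \<bullet> (x - p) - 1 / 2 * (norm v)\<^sup>2"
  have low: "ereal (\<kappa> + 1 / 2 * (norm (y - (x - v)))\<^sup>2) \<le> h y + ereal (q y)" for y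
  proof -
    have "ereal (a + v \<bullet> (y - p)) + ereal (q y) \<le> h y + ereal (q y)"
      using sub a unfolding subgradient_def by (metis add_right_mono plus_ereal.simps(1))
    moreover have "\<kappa> + 1 / 2 * (norm (y - (x - v)))\<^sup>2 = a + v \<bullet> (y - p) + q y"
      unfolding \<kappa>_def q_def power2_norm_eq_inner
      by (simp add: inner_diff inner_commute algebra_simps)
    ultimately show ?thesis by simp
  qed
  have bound: "\<kappa> + 1 / 2 * (norm (y - (x - v)))\<^sup>2 \<le> c" if "y \<in> S c" for y c
    using that low[of y] unfolding S_def by (metis (mono_tags, lifting) ereal_less_eq(3) mem_Collect_eq order_trans)
  have "S c \<subseteq> cball (x - v) (sqrt (2 * (c - \<kappa>)))" for c
  proof
    fix y assume "y \<in> S c"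
    then have "(norm (y - (x - v)))\<^sup>2 \<le> 2 * (c - \<kappa>)" using bound[of y c] by simp
    then have "norm (y - (x - v)) \<le> sqrt (2 * (c - \<kappa>))" by (rule real_le_rsqrt)
    then show "y \<in> cball (x - v) (sqrt (2 * (c - \<kappa>)))"
      by (simp only: mem_cball dist_norm norm_minus_commute)
  qed
  then have "bounded (S c)" for c by (meson bounded_cball bounded_subset)
  moreover have "closed (S c)" for c
    unfolding S_def q_def
    by (intro closed_sublevel_add_continuous closed continuous_intros)
  ultimately have compact: "compact (S c)" for c by (simp add: compact_eq_bounded_closed)
  define m where "m = Inf {c. S c \<noteq> {}}"
  have "p \<in> S (a + q p)" using a by (simp add: S_def)
  then have ne: "{c. S c \<noteq> {}} \<noteq> {}" by blast
  have "\<kappa> \<le> c" if "S c \<noteq> {}" for c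
  proof -
    obtain y where "y \<in> S c" using \<open>S c \<noteq> {}\<close> by blast
    then have "\<kappa> + 1 / 2 * (norm (y - (x - v)))\<^sup>2 \<le> c" by (rule bound)
    moreover have "0 \<le> (norm (y - (x - v)))\<^sup>2" by simp
    ultimately show ?thesis by linarith
  qed
  then have bdd: "bdd_below {c. S c \<noteq> {}}" by (auto simp: bdd_below_def)
  have S_mono: "S c \<subseteq> S c'" if "c \<le> c'" for c c'
    unfolding S_def using that by (auto intro: order_trans)
  have "S (m + 1 / real (Suc n)) \<noteq> {}" for n
  proof -
    have "m < m + 1 / real (Suc n)" by simp
    then obtain c where "S c \<noteq> {}" "c < m + 1 / real (Suc n)"
      using cInf_lessD[OF ne] unfolding m_def by blast
    then show ?thesis using S_mono[of c "m + 1 / real (Suc n)"] by auto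
  qed
  then have "\<Inter>(range (\<lambda>n. S (m + 1 / real (Suc n)))) \<noteq> {}"
    by (intro compact_nest compact S_mono) (auto simp: field_simps)
  then obtain z where z: "\<And>n. z \<in> S (m + 1 / real (Suc n))" by blast
  have "h z + ereal (q z) \<le> ereal m"
  proof (rule ereal_le_epsilon2)
    fix e :: real assume "e > 0"
    then obtain n where "1 / real (Suc n) < e" using nat_approx_posE by blast
    then have "ereal (m + 1 / real (Suc n)) \<le> ereal m + ereal e" by simp
    with z[of n] show "h z + ereal (q z) \<le> ereal m + ereal e"
      unfolding S_def by (blast intro: order_trans)
  qed
  moreover have "ereal m \<le> h y + ereal (q y)" for y
  proof (cases "h y + ereal (q y)")
    case (real c)
    then have "y \<in> S c" unfolding S_def by simp
    then have "S c \<noteq> {}" by blast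
    then have "m \<le> c" unfolding m_def using bdd by (intro cInf_lower) auto
    then show ?thesis using real by simp
  next
    case MInf
    then show ?thesis using low[of y] by simp
  qed auto
  ultimately show ?thesis unfolding q_def by (meson order_trans)
qed

lemma prox_subgradient:
  fixes h :: "real^'n \<Rightarrow> ereal"
  assumes closed: "closed_ext h" and conv: "convex_ext h" and sub: "subgradient h p v"
  shows "subgradient h (prox h x) (x - prox h x)"
proof -
  obtain z where z: "\<And>y. h z + ereal (1 / 2 * (norm (z - x))\<^sup>2) \<le> h y + ereal (1 / 2 * (norm (y - x))\<^sup>2)"
    using prox_objective_attains_minimum[OF closed sub] by blast
  obtain a where a: "h p = ereal a" using sub unfolding subgradient_def by auto
  have nomin: "h y \<noteq> -\<infinity>" for y
    using sub a unfolding subgradient_def by (metis MInfty_neq_ereal(1) ereal_infty_less_eq(2) plus_ereal.simps(1))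
  moreover have "h z \<noteq> \<infinity>" using z[of p] a by auto
  ultimately have "\<bar>h z\<bar> \<noteq> \<infinity>" by auto
  then have "subgradient h z (- (z - x))"
    using minus_gradient_subgradient_at_minimizer[OF conv GDERIV_half_dist_squared] nomin z
    by (simp add: add.commute)
  then have "subgradient h z (x - z)" by simp
  with prox_eqI show ?thesis by metis
qed

text \<open>Monotonicity of the subgradients \<open>x - prox h x\<close>. Firm nonexpansiveness is the only
  property of the proximal map, besides its Newton approximation, that the convergence proof uses.\<close>

lemma prox_firmly_nonexpansive:
  fixes h :: "real^'n \<Rightarrow> ereal"
  assumes "closed_ext h" "convex_ext h" "subgradient h p v"
  shows "(norm (prox h x - prox h y))\<^sup>2 \<le> (prox h x - prox h y) \<bullet> (x - y)"
proof -
  have "((x - prox h x) - (y - prox h y)) \<bullet> (prox h x - prox h y) \<ge> 0"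
    using prox_subgradient[OF assms] by (intro subgradient_monotone)
  then show ?thesis
    unfolding power2_norm_eq_inner by (simp add: inner_diff inner_commute algebra_simps)
qed

section \<open>Scaling an extended real-valued function\<close>

lemma closed_ext_scale:
  assumes "closed_ext g" "\<nu> > 0"
  shows "closed_ext (\<lambda>y. ereal \<nu> * g y)"
proof -
  have "ereal \<nu> * g y \<le> ereal c \<longleftrightarrow> g y \<le> ereal (c / \<nu>)" for y c
    using assms(2) by (cases "g y") (auto simp: field_simps)
  then show ?thesis using assms(1) unfolding closed_ext_def by simp
qed

lemma convex_ext_scale:
  assumes "convex_ext g" "\<nu> > 0" and nomin: "\<And>y. g y \<noteq> -\<infinity>"
  shows "convex_ext (\<lambda>y. ereal \<nu> * g y)"
  unfolding convex_ext_def
proof (intro allI ballI)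
  fix x y and t :: real assume t: "t \<in> {0..1}"
  have "g ((1 - t) *\<^sub>R x + t *\<^sub>R y) \<le> ereal (1 - t) * g x + ereal t * g y"
    using assms(1) t unfolding convex_ext_def by blast
  then have "ereal \<nu> * g ((1 - t) *\<^sub>R x + t *\<^sub>R y) \<le> ereal \<nu> * (ereal (1 - t) * g x + ereal t * g y)"
    using assms(2) by (intro ereal_mult_left_mono) auto
  also have "\<dots> = ereal (1 - t) * (ereal \<nu> * g x) + ereal t * (ereal \<nu> * g y)"
    using t assms(2) nomin[of x] nomin[of y]
    by (cases "g x"; cases "g y") (auto simp: algebra_simps zero_less_mult_iff)
  finally show "ereal \<nu> * g ((1 - t) *\<^sub>R x + t *\<^sub>R y)
    \<le> ereal (1 - t) * (ereal \<nu> * g x) + ereal t * (ereal \<nu> * g y)" .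
qed

lemma subgradient_scale:
  assumes "subgradient g x v" "\<nu> > 0"
  shows "subgradient (\<lambda>y. ereal \<nu> * g y) x (\<nu> *\<^sub>R v)"
proof -
  obtain a where a: "g x = ereal a" using assms(1) unfolding subgradient_def by auto
  have "ereal \<nu> * g x + ereal ((\<nu> *\<^sub>R v) \<bullet> (y - x)) = ereal \<nu> * (g x + ereal (v \<bullet> (y - x)))" for y
    using a by (simp add: algebra_simps)
  moreover have "ereal \<nu> * (g x + ereal (v \<bullet> (y - x))) \<le> ereal \<nu> * g y" for y
    using assms unfolding subgradient_def by (intro ereal_mult_left_mono) auto
  ultimately show ?thesis using a unfolding subgradient_def by simp
qed

section \<open>Derivatives of firmly nonexpansive and of strongly monotone maps\<close>

lemma norm_matrix_vector_mult_le_op_norm: "norm (A *v u) \<le> op_norm A * norm u"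
  for A :: "real^'n^'n"
  unfolding op_norm_def by (intro onorm matrix_vector_mul_bounded_linear)

lemma norm_matrix_vector_mult_le_norm: "norm (A *v u) \<le> norm A * norm u"
  for A :: "real^'n^'n"
proof -
  have "norm (A *v u) = L2_set (\<lambda>i. norm (A $ i \<bullet> u)) UNIV"
    by (simp add: norm_vec_def matrix_mult_dot)
  also have "\<dots> \<le> L2_set (\<lambda>i. norm (A $ i) * norm u) UNIV"
    by (intro L2_set_mono) (simp_all add: Cauchy_Schwarz_ineq2)
  also have "\<dots> = norm A * norm u"
    by (simp add: norm_vec_def[of A] L2_set_left_distrib)
  finally show ?thesis .
qed

lemma op_norm_nonneg: "0 \<le> op_norm A" for A :: "real^'n^'n"
  unfolding op_norm_def by (intro onorm_pos_le matrix_vector_mul_bounded_linear)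

text \<open>The inequality is homogeneous of degree two in the increment, so it passes to difference
  quotients and to their limit.\<close>

lemma firmly_nonexpansive_derivative:
  fixes F :: "'a::real_inner \<Rightarrow> 'a"
  assumes der: "(F has_derivative F') (at z)"
    and firm: "\<And>x y. (norm (F x - F y))\<^sup>2 \<le> (F x - F y) \<bullet> (x - y)"
  shows "(norm (F' d))\<^sup>2 \<le> F' d \<bullet> d"
proof -
  define Q where "Q t = (F (z + t *\<^sub>R d) - F z) /\<^sub>R t" for t
  have lim: "(Q \<longlongrightarrow> F' d) (at_right 0)"
    unfolding Q_def using der by (rule directional_difference_quotient_tendsto)
  have "(norm (Q t))\<^sup>2 \<le> Q t \<bullet> d" if "t > 0" for t
  proof -
    have "F (z + t *\<^sub>R d) - F z = t *\<^sub>R Q t" using that by (simp add: Q_def)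
    then have "t\<^sup>2 * (norm (Q t))\<^sup>2 \<le> t\<^sup>2 * (Q t \<bullet> d)"
      using firm[of "z + t *\<^sub>R d" z] that by (simp add: power_mult_distrib power2_eq_square mult_ac)
    then show ?thesis using that by simp
  qed
  then have "\<forall>\<^sub>F t in at_right 0. (norm (Q t))\<^sup>2 \<le> Q t \<bullet> d"
    by (intro eventually_at_right_less[THEN eventually_mono]) auto
  moreover have "((\<lambda>t. (norm (Q t))\<^sup>2) \<longlongrightarrow> (norm (F' d))\<^sup>2) (at_right 0)"
    and "((\<lambda>t. Q t \<bullet> d) \<longlongrightarrow> F' d \<bullet> d) (at_right 0)"
    using lim by (auto intro!: tendsto_intros)
  ultimately show ?thesis by (intro tendsto_le) auto
qed

text \<open>The elements of the B-subdifferential are limits of Jacobians, and the inequality is a closed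
  condition on the matrix.\<close>

lemma firmly_nonexpansive_B_subdifferential:
  fixes F :: "real^'n \<Rightarrow> real^'n"
  assumes firm: "\<And>x y. (norm (F x - F y))\<^sup>2 \<le> (F x - F y) \<bullet> (x - y)"
    and "V \<in> B_subdifferential F x"
  shows "(norm (V *v w))\<^sup>2 \<le> (V *v w) \<bullet> w"
proof -
  obtain z where diff: "\<And>k. F differentiable (at (z k))"
    and lim: "(\<lambda>k. jacobian F (at (z k))) \<longlonglongrightarrow> V"
    using assms(2) unfolding B_subdifferential_def by blast
  let ?J = "\<lambda>k. jacobian F (at (z k))"
  have "(norm (?J k *v w))\<^sup>2 \<le> (?J k *v w) \<bullet> w" for k
    using diff firmly_nonexpansive_derivative[OF _ firm] unfolding jacobian_works by blast
  moreover have Jw: "(\<lambda>k. ?J k *v w) \<longlonglongrightarrow> V *v w"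
  proof (rule Lim_null_comparison[where g = "\<lambda>k. norm (?J k - V) * norm w", THEN Lim_null[THEN iffD2]])
    show "\<forall>\<^sub>F k in sequentially. norm (?J k *v w - V *v w) \<le> norm (?J k - V) * norm w"
      using norm_matrix_vector_mult_le_norm[of "_ - V" w]
      by (simp add: matrix_vector_mult_diff_rdistrib)
    show "(\<lambda>k. norm (?J k - V) * norm w) \<longlonglongrightarrow> 0"
      using lim by (intro tendsto_mult_left_zero) (simp add: LIM_zero tendsto_norm_zero)
  qed
  moreover have "(\<lambda>k. (norm (?J k *v w))\<^sup>2) \<longlonglongrightarrow> (norm (V *v w))\<^sup>2"
    and "(\<lambda>k. (?J k *v w) \<bullet> w) \<longlonglongrightarrow> (V *v w) \<bullet> w"
    using Jw by (auto intro!: tendsto_intros)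
  ultimately show ?thesis by (intro LIMSEQ_le) auto
qed

text \<open>The strong convexity inequality on the segment from \<open>x\<close> to \<open>y\<close>, divided by the parameter, in the
  limit at \<open>x\<close>.\<close>

lemma strongly_convex_gradient_inequality:
  assumes "strongly_convex \<mu> f" and grad: "GDERIV f x :> D"
  shows "f x + D \<bullet> (y - x) + \<mu> / 2 * (norm (y - x))\<^sup>2 \<le> f y"
proof -
  let ?c = "f y - f x"  and ?n = "(norm (y - x))\<^sup>2"
  have "(f (x + t *\<^sub>R (y - x)) - f x) /\<^sub>R t \<le> ?c - \<mu> / 2 * (1 - t) * ?n"
    if t: "0 < t" "t < 1" for t
  proof -
    have "f ((1 - t) *\<^sub>R x + t *\<^sub>R y)
        \<le> (1 - t) * f x + t * f y - \<mu> / 2 * t * (1 - t) * (norm (x - y))\<^sup>2"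
      using assms(1) t unfolding strongly_convex_def by simp
    moreover have "(1 - t) *\<^sub>R x + t *\<^sub>R y = x + t *\<^sub>R (y - x)"
      by (simp add: algebra_simps)
    ultimately have "f (x + t *\<^sub>R (y - x)) - f x \<le> t * (?c - \<mu> / 2 * (1 - t) * ?n)"
      by (simp add: norm_minus_commute algebra_simps)
    then show ?thesis using t by (simp add: field_simps)
  qed
  then have "\<forall>\<^sub>F t in at_right 0.
      (f (x + t *\<^sub>R (y - x)) - f x) /\<^sub>R t \<le> ?c - \<mu> / 2 * (1 - t) * ?n"
    unfolding eventually_at_right_field by (intro exI[of _ 1]) auto
  moreover have "((\<lambda>t. (f (x + t *\<^sub>R (y - x)) - f x) /\<^sub>R t) \<longlongrightarrow> (y - x) \<bullet> D) (at_right 0)"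
    using directional_difference_quotient_tendsto grad unfolding gderiv_def by blast
  moreover have "((\<lambda>t. ?c - \<mu> / 2 * (1 - t) * ?n) \<longlongrightarrow> ?c - \<mu> / 2 * (1 - 0) * ?n) (at_right 0)"
    by (intro tendsto_intros)
  ultimately have "(y - x) \<bullet> D \<le> ?c - \<mu> / 2 * (1 - 0) * ?n"
    by (intro tendsto_le) auto
  then show ?thesis by (simp add: inner_commute)
qed

lemma strongly_monotone_derivative:
  fixes F :: "'a::real_inner \<Rightarrow> 'a"
  assumes der: "(F has_derivative F') (at z)"
    and mono: "\<And>x y. \<mu> * (norm (x - y))\<^sup>2 \<le> (F x - F y) \<bullet> (x - y)"
  shows "\<mu> * (norm d)\<^sup>2 \<le> F' d \<bullet> d"
proof -
  define Q where "Q t = (F (z + t *\<^sub>R d) - F z) /\<^sub>R t" for t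
  have "(Q \<longlongrightarrow> F' d) (at_right 0)"
    unfolding Q_def using der by (rule directional_difference_quotient_tendsto)
  then have "((\<lambda>t. Q t \<bullet> d) \<longlongrightarrow> F' d \<bullet> d) (at_right 0)"
    by (intro tendsto_intros)
  moreover have "\<mu> * (norm d)\<^sup>2 \<le> Q t \<bullet> d" if "t > 0" for t
  proof -
    have "F (z + t *\<^sub>R d) - F z = t *\<^sub>R Q t" using that by (simp add: Q_def)
    then have "t\<^sup>2 * (\<mu> * (norm d)\<^sup>2) \<le> t\<^sup>2 * (Q t \<bullet> d)"
      using mono[of "z + t *\<^sub>R d" z] by (simp add: power_mult_distrib power2_eq_square mult_ac)
    then show ?thesis using that by simp
  qed
  then have "\<forall>\<^sub>F t in at_right 0. \<mu> * (norm d)\<^sup>2 \<le> Q t \<bullet> d"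
    by (intro eventually_at_right_less[THEN eventually_mono]) auto
  ultimately show ?thesis by (intro tendsto_lowerbound) auto
qed

text \<open>Adding the gradient inequalities at two points shows that the gradient is strongly monotone;
  the Hessian inherits this as a derivative.\<close>

lemma strongly_convex_hessian_lower_bound:
  assumes "twice_continuously_differentiable f" and sc: "strongly_convex \<mu> f"
  shows "\<mu> * (norm u)\<^sup>2 \<le> (hessian f x *v u) \<bullet> u"
proof -
  have grad: "GDERIV f y :> gradient f y" for y
    using assms(1) GDERIV_gradient unfolding twice_continuously_differentiable_def by blast
  have "\<mu> * (norm (y - z))\<^sup>2 \<le> (gradient f y - gradient f z) \<bullet> (y - z)" for y z
    using strongly_convex_gradient_inequality[OF sc grad, of y z]
      strongly_convex_gradient_inequality[OF sc grad, of z y]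
    by (simp add: norm_minus_commute inner_diff field_simps)
  moreover have "(gradient f has_derivative (\<lambda>h. hessian f x *v h)) (at x)"
    using assms(1) unfolding twice_continuously_differentiable_def hessian_def jacobian_works by blast
  ultimately show ?thesis using strongly_monotone_derivative by blast
qed

section \<open>The Newton step\<close>

text \<open>The heart of the proof: the Newton matrices are uniformly invertible. With
  \<open>r\<close> the image of \<open>u\<close> and \<open>w = u - \<nu> B u\<close> we have \<open>V w = u - r\<close>, so firm nonexpansiveness of \<open>V\<close>
  reads \<open>\<parallel>u - r\<parallel>\<^sup>2 \<le> (u - r) \<bullet> (u - \<nu> B u)\<close>. The terms \<open>u \<bullet> u\<close> cancel, and what remains bounds the
  quadratic form of \<open>B\<close> at \<open>u\<close> by products of \<open>r\<close> with \<open>u\<close> and \<open>B u\<close>. Arguing with this inequality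
  in place of the eigenvalues of \<open>V\<close> avoids showing that Jacobians of a proximal map are symmetric.\<close>

lemma newton_matrix_lower_bound:
  fixes V B :: "real^'n^'n"
  assumes firm: "\<And>w. (norm (V *v w))\<^sup>2 \<le> (V *v w) \<bullet> w"
    and pos: "\<And>u. m * (norm u)\<^sup>2 \<le> (B *v u) \<bullet> u"
    and bound: "\<And>u. norm (B *v u) \<le> K * norm u"
    and "\<nu> > 0"
  shows "\<nu> * m * norm u \<le> (1 + \<nu> * K) * norm ((mat 1 - V ** (mat 1 - \<nu> *\<^sub>R B)) *v u)"
proof (cases "u = 0")
  case False
  define r where "r = (mat 1 - V ** (mat 1 - \<nu> *\<^sub>R B)) *v u"
  have "V *v (u - \<nu> *\<^sub>R (B *v u)) = u - r"
    unfolding r_def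
    by (simp add: matrix_vector_mult_diff_rdistrib matrix_vector_mul_assoc[symmetric]
        scaleR_matrix_vector_assoc)
  then have "(norm (u - r))\<^sup>2 \<le> (u - r) \<bullet> (u - \<nu> *\<^sub>R (B *v u))"
    using firm[of "u - \<nu> *\<^sub>R (B *v u)"] by simp
  then have "\<nu> * ((B *v u) \<bullet> u) + r \<bullet> r \<le> r \<bullet> u + \<nu> * (r \<bullet> (B *v u))"
    unfolding power2_norm_eq_inner by (simp add: inner_diff inner_commute algebra_simps)
  moreover have "0 \<le> r \<bullet> r" by simp
  moreover have "r \<bullet> u \<le> norm r * norm u" by (rule norm_cauchy_schwarz)
  moreover have "\<nu> * (r \<bullet> (B *v u)) \<le> \<nu> * (norm r * (K * norm u))"
    using \<open>\<nu> > 0\<close> bound[of u]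
    by (intro mult_left_mono order_trans[OF norm_cauchy_schwarz]) auto
  moreover have "\<nu> * (m * (norm u)\<^sup>2) \<le> \<nu> * ((B *v u) \<bullet> u)"
    using \<open>\<nu> > 0\<close> pos by (intro mult_left_mono) auto
  ultimately have "\<nu> * (m * (norm u)\<^sup>2) \<le> norm r * norm u + \<nu> * (norm r * (K * norm u))"
    by linarith
  then have "(\<nu> * m * norm u) * norm u \<le> ((1 + \<nu> * K) * norm r) * norm u"
    by (simp add: power2_eq_square algebra_simps)
  then show ?thesis using False unfolding r_def by simp
qed simp

lemma matrix_inv_cancel:
  fixes M :: "real^'n^'n"
  assumes "\<And>u. M *v u = 0 \<Longrightarrow> u = 0"
  shows "M *v (matrix_inv M *v u) = u"
proof -
  have "\<exists>N. N ** M = mat 1"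
    using assms matrix_left_invertible_ker by blast
  then have "\<exists>N. M ** N = mat 1 \<and> N ** M = mat 1"
    by (metis matrix_left_right_inverse)
  then have "M ** matrix_inv M = mat 1"
    unfolding matrix_inv_def by (metis (mono_tags, lifting) someI_ex)
  then show ?thesis by (simp add: matrix_vector_mul_assoc)
qed

text \<open>The new error, multiplied by the Newton matrix, splits into the linearization error of the
  proximal map \<open>P\<close> and that of the gradient \<open>G\<close>, the latter with \<open>B\<close> in place of the Hessian. Both
  vanish to first order if \<open>B\<close> is the exact Hessian at \<open>xs\<close>.\<close>

lemma newton_step_error:
  fixes V B :: "real^'n^'n" and P G :: "real^'n \<Rightarrow> real^'n" and x xs :: "real^'n"
  assumes "P (xs - \<nu> *\<^sub>R G xs) = xs"
    and "\<And>u. M *v u = 0 \<Longrightarrow> u = 0"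
    and M: "M = mat 1 - V ** (mat 1 - \<nu> *\<^sub>R B)"
  shows "M *v (x - matrix_inv M *v (x - P (x - \<nu> *\<^sub>R G x)) - xs)
    = (P (x - \<nu> *\<^sub>R G x) - P (xs - \<nu> *\<^sub>R G xs)
        - V *v ((x - \<nu> *\<^sub>R G x) - (xs - \<nu> *\<^sub>R G xs)))
      - \<nu> *\<^sub>R (V *v (G x - G xs - B *v (x - xs)))"
proof -
  let ?p = "x - \<nu> *\<^sub>R G x" and ?ps = "xs - \<nu> *\<^sub>R G xs" and ?e = "x - xs"
  have "M *v (x - matrix_inv M *v (x - P ?p) - xs) = M *v ?e - (x - P ?p)"
    using matrix_inv_cancel[OF assms(2)]
    by (simp add: matrix_vector_mult_diff_distrib algebra_simps)
  also have "M *v ?e = ?e - V *v (?e - \<nu> *\<^sub>R (B *v ?e))"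
    unfolding M
    by (simp add: matrix_vector_mult_diff_rdistrib matrix_vector_mul_assoc[symmetric]
        scaleR_matrix_vector_assoc)
  also have "?e - \<nu> *\<^sub>R (B *v ?e) = (?p - ?ps) + \<nu> *\<^sub>R (G x - G xs - B *v ?e)"
    by (simp add: algebra_simps)
  finally show ?thesis
    using assms(1)
    by (simp add: matrix_vector_right_distrib matrix_vector_mult_scaleR algebra_simps)
qed

text \<open>Besides the lower bound for the Newton matrix and the splitting of the error, this uses that
  \<open>V\<close> is nonexpansive, which follows from the firm inequality by Cauchy-Schwarz.\<close>

lemma quasi_newton_step_bound:
  fixes V B :: "real^'n^'n" and P G :: "real^'n \<Rightarrow> real^'n" and x xs :: "real^'n"
  assumes firm: "\<And>w. (norm (V *v w))\<^sup>2 \<le> (V *v w) \<bullet> w"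
    and pos: "\<And>u. m * (norm u)\<^sup>2 \<le> (B *v u) \<bullet> u"
    and bound: "\<And>u. norm (B *v u) \<le> K * norm u"
    and "\<nu> > 0" "m > 0" "K \<ge> 0"
    and fixed: "P (xs - \<nu> *\<^sub>R G xs) = xs"
    and \<alpha>: "norm (P (x - \<nu> *\<^sub>R G x) - P (xs - \<nu> *\<^sub>R G xs)
        - V *v ((x - \<nu> *\<^sub>R G x) - (xs - \<nu> *\<^sub>R G xs))) \<le> \<alpha>"
    and \<beta>: "norm (G x - G xs - B *v (x - xs)) \<le> \<beta>"
  shows "\<nu> * m * norm (x - matrix_inv (mat 1 - V ** (mat 1 - \<nu> *\<^sub>R B)) *v (x - P (x - \<nu> *\<^sub>R G x)) - xs)
    \<le> (1 + \<nu> * K) * (\<alpha> + \<nu> * \<beta>)"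
proof -
  define M where "M = mat 1 - V ** (mat 1 - \<nu> *\<^sub>R B)"
  have low: "\<nu> * m * norm u \<le> (1 + \<nu> * K) * norm (M *v u)" for u
    unfolding M_def using newton_matrix_lower_bound[OF firm pos bound \<open>\<nu> > 0\<close>] .
  have "u = 0" if "M *v u = 0" for u
    using low[of u] that \<open>\<nu> > 0\<close> \<open>m > 0\<close> by (simp add: mult_le_0_iff)
  note error = newton_step_error[where P = P and G = G and x = x, OF fixed this M_def]
  have nonexp: "norm (V *v w) \<le> norm w" for w
  proof (cases "V *v w = 0")
    case False
    have "norm (V *v w) * norm (V *v w) \<le> norm (V *v w) * norm w"
      using firm[of w] norm_cauchy_schwarz[of "V *v w" w] by (simp add: power2_eq_square)
    then show ?thesis using False by simp
  qed simp
  have V\<beta>: "norm (\<nu> *\<^sub>R (V *v (G x - G xs - B *v (x - xs)))) \<le> \<nu> * \<beta>"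
    using \<open>\<nu> > 0\<close> nonexp \<beta> by (auto intro: order_trans)
  have "norm (M *v (x - matrix_inv M *v (x - P (x - \<nu> *\<^sub>R G x)) - xs)) \<le> \<alpha> + \<nu> * \<beta>"
    using order_trans[OF norm_triangle_ineq4 add_mono[OF \<alpha> V\<beta>]] by (subst error)
  then have "(1 + \<nu> * K) * norm (M *v (x - matrix_inv M *v (x - P (x - \<nu> *\<^sub>R G x)) - xs))
      \<le> (1 + \<nu> * K) * (\<alpha> + \<nu> * \<beta>)"
    using \<open>\<nu> > 0\<close> \<open>K \<ge> 0\<close> by (intro mult_left_mono) auto
  with low show ?thesis unfolding M_def by (blast intro: order_trans)
qed

section \<open>Local estimates and linear convergence\<close>

lemma converges_linearly_if_locally_halving:
  assumes start: "norm (x 1 - xs) < \<epsilon>"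
    and step: "\<And>k. k \<ge> 1 \<Longrightarrow> norm (x k - xs) < \<epsilon> \<Longrightarrow> norm (x (Suc k) - xs) \<le> 1 / 2 * norm (x k - xs)"
  shows "converges_linearly x xs"
proof -
  have near: "norm (x (Suc n) - xs) < \<epsilon> \<and> norm (x (Suc n) - xs) \<le> \<epsilon> * (1 / 2) ^ n" for n
  proof (induction n)
    case 0
    then show ?case using start by simp
  next
    case (Suc n)
    then have "norm (x (Suc (Suc n)) - xs) \<le> 1 / 2 * norm (x (Suc n) - xs)"
      using step[of "Suc n"] by simp
    moreover from this have "norm (x (Suc (Suc n)) - xs) < \<epsilon>"
      using Suc norm_ge_zero[of "x (Suc n) - xs"] by linarith
    ultimately show ?case using Suc by simp
  qed
  have half: "norm (x (Suc k) - xs) \<le> 1 / 2 * norm (x k - xs)" if "k \<ge> 1" for k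
    using step[OF that] near[of "k - 1"] that by simp
  have "(\<lambda>n. x (Suc n) - xs) \<longlonglongrightarrow> 0"
  proof (rule Lim_null_comparison)
    show "\<forall>\<^sub>F n in sequentially. norm (x (Suc n) - xs) \<le> \<epsilon> * (1 / 2) ^ n"
      using near by simp
    show "(\<lambda>n. \<epsilon> * (1 / 2) ^ n) \<longlonglongrightarrow> 0"
      by (intro tendsto_mult_right_zero LIMSEQ_realpow_zero) auto
  qed
  then have "x \<longlonglongrightarrow> xs" by (simp add: LIM_zero_iff filterlim_sequentially_Suc[of x])
  with half show ?thesis
    unfolding converges_linearly_def by (intro conjI exI[of _ "1 / 2"]) auto
qed


text \<open>Differentiability of the gradient at \<open>xs\<close>, continuity of the Hessian there and the closeness of
  \<open>B\<close> to the Hessian at \<open>x\<close> each contribute one \<open>\<eta>\<close>. Continuity is available in the Frobenius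
  norm, which dominates the operator norm by \<open>norm_matrix_vector_mult_le_norm\<close>.\<close>

lemma gradient_step_deviation:
  fixes f :: "real^'n \<Rightarrow> real"
  assumes smooth: "twice_continuously_differentiable f" and "\<eta> > 0"
  shows "\<exists>\<delta>>0. \<forall>x B. norm (x - xs) < \<delta> \<longrightarrow> op_norm (B - hessian f x) < \<eta> \<longrightarrow>
    norm (gradient f x - gradient f xs - B *v (x - xs)) \<le> 3 * \<eta> * norm (x - xs) \<and>
    norm (gradient f x - gradient f xs) \<le> (op_norm (hessian f xs) + \<eta>) * norm (x - xs) \<and>
    (\<forall>u. norm ((B - hessian f xs) *v u) \<le> 2 * \<eta> * norm u)"
proof -
  let ?H = "hessian f xs" and ?G = "gradient f"
  have "(?G has_derivative (\<lambda>h. ?H *v h)) (at xs)"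
    using smooth unfolding twice_continuously_differentiable_def hessian_def jacobian_works by blast
  then obtain \<delta>1 where \<delta>1: "\<delta>1 > 0"
    "\<And>x. norm (x - xs) < \<delta>1 \<Longrightarrow> norm (?G x - ?G xs - ?H *v (x - xs)) \<le> \<eta> * norm (x - xs)"
    using \<open>\<eta> > 0\<close> unfolding has_derivative_at_alt by blast
  have "continuous_on UNIV (hessian f)"
    using smooth unfolding twice_continuously_differentiable_def by blast
  then obtain \<delta>2 where \<delta>2: "\<delta>2 > 0" "\<And>x. norm (x - xs) < \<delta>2 \<Longrightarrow> norm (hessian f x - ?H) < \<eta>"
    using \<open>\<eta> > 0\<close> unfolding continuous_on_iff dist_norm by (metis UNIV_I)
  have "norm (?G x - ?G xs - B *v (x - xs)) \<le> 3 * \<eta> * norm (x - xs) \<and>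
    norm (?G x - ?G xs) \<le> (op_norm ?H + \<eta>) * norm (x - xs) \<and>
    (\<forall>u. norm ((B - ?H) *v u) \<le> 2 * \<eta> * norm u)"
    if x: "norm (x - xs) < min \<delta>1 \<delta>2" and B: "op_norm (B - hessian f x) < \<eta>" for x B
  proof (intro conjI allI)
    have lin: "norm (?G x - ?G xs - ?H *v (x - xs)) \<le> \<eta> * norm (x - xs)"
      using \<delta>1 x by simp
    show BH: "norm ((B - ?H) *v u) \<le> 2 * \<eta> * norm u" for u
    proof -
      have "(B - ?H) *v u = (B - hessian f x) *v u + (hessian f x - ?H) *v u"
        by (simp add: matrix_vector_mult_diff_rdistrib)
      then have "norm ((B - ?H) *v u)
          \<le> op_norm (B - hessian f x) * norm u + norm (hessian f x - ?H) * norm u"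
        by (metis add_mono norm_matrix_vector_mult_le_norm norm_matrix_vector_mult_le_op_norm
            norm_triangle_le)
      also have "\<dots> \<le> \<eta> * norm u + \<eta> * norm u"
        using B \<delta>2 x by (intro add_mono mult_right_mono) (auto intro: less_imp_le)
      finally show ?thesis by simp
    qed
    have "?G x - ?G xs - B *v (x - xs)
        = (?G x - ?G xs - ?H *v (x - xs)) - (B - ?H) *v (x - xs)"
      by (simp add: matrix_vector_mult_diff_rdistrib)
    then have "norm (?G x - ?G xs - B *v (x - xs))
        \<le> norm (?G x - ?G xs - ?H *v (x - xs)) + norm ((B - ?H) *v (x - xs))"
      by (metis norm_triangle_ineq4)
    then show "norm (?G x - ?G xs - B *v (x - xs)) \<le> 3 * \<eta> * norm (x - xs)"
      using lin BH[of "x - xs"] by linarith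
    have "norm (?G x - ?G xs)
        \<le> norm (?G x - ?G xs - ?H *v (x - xs)) + norm (?H *v (x - xs))"
      by (metis diff_add_cancel norm_triangle_ineq)
    then show "norm (?G x - ?G xs) \<le> (op_norm ?H + \<eta>) * norm (x - xs)"
      using lin norm_matrix_vector_mult_le_op_norm[of ?H "x - xs"] by (simp add: algebra_simps)
  qed
  moreover have "min \<delta>1 \<delta>2 > 0" using \<delta>1 \<delta>2 by simp
  ultimately show ?thesis by blast
qed

theorem theorem2:
  fixes f :: "real^'n \<Rightarrow> real" and g :: "real^'n \<Rightarrow> ereal"
    and \<mu> \<nu> :: real and xs :: "real^'n"
  assumes "twice_continuously_differentiable f"
    and "\<mu> > 0" and "strongly_convex \<mu> f"
    and "\<And>x. g x \<noteq> -\<infinity>" and "\<exists>x. g x \<noteq> \<infinity>"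
    and "closed_ext g" and "convex_ext g"
    and "\<nu> > 0"
    and "is_arg_min (\<lambda>x. ereal (f x) + g x) (\<lambda>_. True) xs"
    and "LNA (prox (\<lambda>y. ereal \<nu> * g y))
           (B_subdifferential (prox (\<lambda>y. ereal \<nu> * g y))) (xs - \<nu> *\<^sub>R gradient f xs)"
  shows "\<exists>\<epsilon>>0. \<exists>\<Delta>>0. \<forall>x B.
           hybrid_quasi_newton f g \<nu> xs x B \<longrightarrow>
           norm (x 1 - xs) < \<epsilon> \<longrightarrow>
           (\<forall>k\<ge>1. op_norm (B k - hessian f (x k)) < \<Delta>) \<longrightarrow>
           converges_linearly x xs"
proof -
  note smooth = assms(1) and sc = assms(3) and nomin = assms(4) and \<open>\<mu> > 0\<close> \<open>\<nu> > 0\<close>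
  let ?G = "gradient f" and ?H = "hessian f xs"
  define h where "h = (\<lambda>y. ereal \<nu> * g y)"
  define P where "P = prox h"
  define ps where "ps = xs - \<nu> *\<^sub>R ?G xs"
  have min: "ereal (f xs) + g xs \<le> ereal (f y) + g y" for y
    using assms(9) by (simp add: is_arg_min_linorder)
  have "g xs \<noteq> \<infinity>"
  proof
    assume "g xs = \<infinity>"
    moreover obtain z where "g z \<noteq> \<infinity>" using assms(5) by blast
    ultimately show False using min[of z] by simp
  qed
  then have fin: "\<bar>g xs\<bar> \<noteq> \<infinity>" using nomin by auto
  have grad: "GDERIV f xs :> ?G xs"
    using smooth GDERIV_gradient unfolding twice_continuously_differentiable_def by blast
  have "subgradient g xs (- ?G xs)"
    by (rule minus_gradient_subgradient_at_minimizer[OF assms(7) grad fin nomin min])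
  then have "subgradient h xs (\<nu> *\<^sub>R (- ?G xs))"
    unfolding h_def using \<open>\<nu> > 0\<close> by (rule subgradient_scale)
  then have sub: "subgradient h xs (ps - xs)" by (simp add: ps_def)
  have fixed: "P (xs - \<nu> *\<^sub>R ?G xs) = xs"
    using prox_eqI[OF sub] unfolding P_def ps_def .
  have "closed_ext h" "convex_ext h"
    unfolding h_def using assms closed_ext_scale convex_ext_scale by blast+
  then have firm: "(norm (P x - P y))\<^sup>2 \<le> (P x - P y) \<bullet> (x - y)" for x y
    unfolding P_def using sub by (rule prox_firmly_nonexpansive)

  \<comment> \<open>\<open>L\<close> bounds the matrices \<open>B\<close> and the Lipschitz constant of the gradient at \<open>xs\<close>; the three
      bounds on \<open>\<eta>\<close> keep \<open>B\<close> above \<open>\<mu> / 2\<close>, keep it below \<open>L\<close>, and make the contraction factor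
      \<open>C \<eta> / (\<nu> \<mu> / 2)\<close> of a step at most \<open>1 / 2\<close>\<close>
  define L where "L = op_norm ?H + 1"
  define C where "C = (1 + \<nu> * L) * ((1 + \<nu> * L) + 3 * \<nu>)"
  have "L > 0" unfolding L_def using op_norm_nonneg[of ?H] by simp
  then have "C > 0" unfolding C_def using \<open>\<nu> > 0\<close> by (simp add: add_pos_pos)
  define \<eta> where "\<eta> = min (min (\<mu> / 4) (1 / 2)) (\<nu> * \<mu> / (4 * C))"
  have \<eta>: "\<eta> > 0" "\<eta> \<le> \<mu> / 4" "\<eta> \<le> 1 / 2" "\<eta> \<le> \<nu> * \<mu> / (4 * C)"
    unfolding \<eta>_def using \<open>\<mu> > 0\<close> \<open>\<nu> > 0\<close> \<open>C > 0\<close> by auto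
  then have C\<eta>: "C * \<eta> \<le> \<nu> * \<mu> / 4" using \<open>C > 0\<close> by (simp add: field_simps)

  obtain \<delta>1 where \<delta>1: "\<delta>1 > 0"
    "\<And>x B. norm (x - xs) < \<delta>1 \<Longrightarrow> op_norm (B - hessian f x) < \<eta> \<Longrightarrow>
      norm (?G x - ?G xs - B *v (x - xs)) \<le> 3 * \<eta> * norm (x - xs) \<and>
      norm (?G x - ?G xs) \<le> (op_norm ?H + \<eta>) * norm (x - xs) \<and>
      (\<forall>u. norm ((B - ?H) *v u) \<le> 2 * \<eta> * norm u)"
    using gradient_step_deviation[OF smooth \<eta>(1), of xs] by blast
  obtain \<delta>2 where \<delta>2: "\<delta>2 > 0"
    "\<And>y V. norm (ps - y) < \<delta>2 \<Longrightarrow> V \<in> B_subdifferential P y \<Longrightarrow>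
      norm (P ps - P y - V *v (ps - y)) \<le> \<eta> * norm (ps - y)"
    using assms(10) \<eta>(1) unfolding LNA_def P_def h_def ps_def by meson
  \<comment> \<open>the forward step \<open>x - \<nu> \<nabla>f x\<close> moves at most \<open>1 + \<nu> L\<close> times as far from \<open>ps\<close> as \<open>x\<close> from \<open>xs\<close>\<close>
  define \<epsilon> where "\<epsilon> = min \<delta>1 (\<delta>2 / (1 + \<nu> * L))"
  have one_L: "1 + \<nu> * L > 0" using \<open>\<nu> > 0\<close> \<open>L > 0\<close> by (simp add: add_pos_pos)
  then have "\<epsilon> > 0" unfolding \<epsilon>_def using \<delta>1 \<delta>2 by simp

  have step: "norm (x - matrix_inv (mat 1 - V ** (mat 1 - \<nu> *\<^sub>R B)) *v (x - P (x - \<nu> *\<^sub>R ?G x)) - xs)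
      \<le> 1 / 2 * norm (x - xs)"
    if x: "norm (x - xs) < \<epsilon>" and B: "op_norm (B - hessian f x) < \<eta>"
      and V: "V \<in> B_subdifferential P (x - \<nu> *\<^sub>R ?G x)" for x B V
  proof -
    let ?p = "x - \<nu> *\<^sub>R ?G x" and ?e = "norm (x - xs)"
    have "?e < \<delta>1" using x by (simp add: \<epsilon>_def)
    note dev = \<delta>1(2)[OF this B]
    have BH: "norm ((B - ?H) *v u) \<le> 2 * \<eta> * norm u" for u using dev by blast
    have B_split: "B *v u = ?H *v u + (B - ?H) *v u" for u
      by (simp add: matrix_vector_mult_diff_rdistrib)
    have pos: "\<mu> / 2 * (norm u)\<^sup>2 \<le> (B *v u) \<bullet> u" for u
    proof -
      have "\<bar>((B - ?H) *v u) \<bullet> u\<bar> \<le> norm ((B - ?H) *v u) * norm u"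
        by (rule Cauchy_Schwarz_ineq2)
      also have "\<dots> \<le> \<mu> / 2 * norm u * norm u"
        using BH[of u] \<eta>(2) by (intro mult_right_mono order_trans[OF BH]) auto
      finally have "\<bar>((B - ?H) *v u) \<bullet> u\<bar> \<le> \<mu> / 2 * (norm u)\<^sup>2"
        by (simp add: power2_eq_square)
      moreover have "\<mu> * (norm u)\<^sup>2 \<le> (?H *v u) \<bullet> u"
        using strongly_convex_hessian_lower_bound[OF smooth sc] .
      moreover have "(B *v u) \<bullet> u = (?H *v u) \<bullet> u + ((B - ?H) *v u) \<bullet> u"
        unfolding B_split[of u] by (rule inner_add_left)
      moreover have "\<mu> * (norm u)\<^sup>2 = \<mu> / 2 * (norm u)\<^sup>2 + \<mu> / 2 * (norm u)\<^sup>2" by simp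
      ultimately show ?thesis by linarith
    qed
    have bound: "norm (B *v u) \<le> L * norm u" for u
    proof -
      have "norm (B *v u) \<le> op_norm ?H * norm u + 2 * \<eta> * norm u"
        unfolding B_split[of u]
        by (intro norm_triangle_le add_mono norm_matrix_vector_mult_le_op_norm BH)
      also have "\<dots> = (op_norm ?H + 2 * \<eta>) * norm u" by (simp add: algebra_simps)
      also have "\<dots> \<le> L * norm u" unfolding L_def using \<eta>(3) by (intro mult_right_mono) auto
      finally show ?thesis .
    qed
    have "norm (?G x - ?G xs) \<le> (op_norm ?H + \<eta>) * ?e" using dev by blast
    also have "\<dots> \<le> L * ?e" unfolding L_def using \<eta>(3) by (intro mult_right_mono) auto
    finally have "\<nu> * norm (?G x - ?G xs) \<le> \<nu> * (L * ?e)"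
      using \<open>\<nu> > 0\<close> by (intro mult_left_mono) auto
    moreover have ps_diff: "ps - ?p = (xs - x) + \<nu> *\<^sub>R (?G x - ?G xs)"
      by (simp add: ps_def algebra_simps)
    have "norm (ps - ?p) \<le> ?e + \<nu> * norm (?G x - ?G xs)"
      unfolding ps_diff
      using norm_triangle_ineq[of "xs - x" "\<nu> *\<^sub>R (?G x - ?G xs)"] \<open>\<nu> > 0\<close>
      by (simp add: norm_minus_commute)
    ultimately have dist_p: "norm (ps - ?p) \<le> (1 + \<nu> * L) * ?e" by (simp add: algebra_simps)
    also have "\<dots> < \<delta>2"
      using x one_L by (simp add: \<epsilon>_def pos_less_divide_eq mult.commute)
    finally have "norm (P ps - P ?p - V *v (ps - ?p)) \<le> \<eta> * norm (ps - ?p)"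
      using V by (rule \<delta>2(2))
    also have "\<dots> \<le> \<eta> * ((1 + \<nu> * L) * ?e)" using dist_p \<eta>(1) by (intro mult_left_mono) auto
    also have "P ps - P ?p - V *v (ps - ?p) = - (P ?p - P ps - V *v (?p - ps))"
      by (simp add: matrix_vector_mult_diff_distrib)
    finally have \<alpha>: "norm (P ?p - P ps - V *v (?p - ps)) \<le> \<eta> * ((1 + \<nu> * L) * ?e)"
      by (simp only: norm_minus_cancel)
    have "\<nu> * (\<mu> / 2) * norm (x - matrix_inv (mat 1 - V ** (mat 1 - \<nu> *\<^sub>R B)) *v (x - P ?p) - xs)
        \<le> (1 + \<nu> * L) * (\<eta> * ((1 + \<nu> * L) * ?e) + \<nu> * (3 * \<eta> * ?e))"
      using quasi_newton_step_bound[where P = P and G = ?G,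
          OF firmly_nonexpansive_B_subdifferential[OF firm V] pos bound \<open>\<nu> > 0\<close> _ _ fixed
            \<alpha>[unfolded ps_def]] dev \<open>\<mu> > 0\<close> \<open>L > 0\<close> by simp
    also have "\<dots> = (C * \<eta>) * ?e" unfolding C_def by (simp add: algebra_simps)
    also have "\<dots> \<le> (\<nu> * \<mu> / 4) * ?e" using C\<eta> by (intro mult_right_mono) auto
    also have "\<dots> = \<nu> * (\<mu> / 2) * (1 / 2 * ?e)" by simp
    finally show ?thesis using \<open>\<nu> > 0\<close> \<open>\<mu> > 0\<close> by simp
  qed

  have "converges_linearly x xs"
    if run: "hybrid_quasi_newton f g \<nu> xs x B" and start: "norm (x 1 - xs) < \<epsilon>"
      and close: "\<forall>k\<ge>1. op_norm (B k - hessian f (x k)) < \<eta>" for x B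
  proof (rule converges_linearly_if_locally_halving[where x = x, OF start])
    fix k :: nat assume k: "k \<ge> 1" "norm (x k - xs) < \<epsilon>"
    show "norm (x (Suc k) - xs) \<le> 1 / 2 * norm (x k - xs)"
    proof (cases "x k = xs")
      case True
      then show ?thesis using run k(1) unfolding hybrid_quasi_newton_def by simp
    next
      case False
      then obtain V where V: "V \<in> B_subdifferential P (x k - \<nu> *\<^sub>R ?G (x k))"
        and "x (Suc k) = x k + (- (matrix_inv (mat 1 - V ** (mat 1 - \<nu> *\<^sub>R B k))
            *v prox_residual f g \<nu> (x k)))"
        using run k(1) unfolding hybrid_quasi_newton_def P_def h_def by metis
      then have "x (Suc k) = x k - matrix_inv (mat 1 - V ** (mat 1 - \<nu> *\<^sub>R B k))
          *v (x k - P (x k - \<nu> *\<^sub>R ?G (x k)))"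
        by (simp add: prox_residual_def P_def h_def)
      with step[OF k(2) _ V, of "B k"] close k(1) show ?thesis by simp
    qed
  qed
  with \<open>\<epsilon> > 0\<close> \<eta>(1) show ?thesis by blast
qed

end
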